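(* Let $\lambda\in\mathbb{R}$, let $y,z\in\mathbb{C}$ with $z\neq 0$, and let $f_{\lambda}(t)=\sum_{k=0}^{\infty}a_{k}(t)_{k,\lambda}$ be a degenerate formal power series. Then for every integer $n\ge 0$, $$\sum_{k=0}^{n}\binom{n}{k}(-1)^{k}f_{\lambda}(y+zk)=(-1)^{n}n!\sum_{m=0}^{\infty}a_{m}\bigg\{\sum_{p=0}^{m}\binom{m}{p}S_{2,\frac{\lambda}{z}}(p,n)z^{p}(y)_{m-p,\lambda}\bigg\}.$$ In particular, for $y=0$, $$\sum_{k=0}^{n}\binom{n}{k}(-1)^{k}f_{\lambda}(zk)=(-1)^{n}n!\sum_{m=0}^{\infty}a_{m}S_{2,\frac{\lambda}{z}}(m,n)z^{m}.$$ Both identities are understood formally in the coefficients $a_m$, i.e. for each $m\ge 0$ the coefficients of $a_m$ on the two sides are equal.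
   Context: For a complex number $\mu$, the $\mu$-falling factorials are $(x)_{0,\mu}=1$ and $(x)_{n,\mu}=x(x-\mu)(x-2\mu)\cdots(x-(n-1)\mu)$ for $n\ge1$; the ordinary falling factorials are $(x)_0=1$, $(x)_n=x(x-1)\cdots(x-n+1)$ for $n\ge 1$. The degenerate Stirling numbers of the second kind $S_{2,\mu}(n,k)$ are defined by the polynomial identity $(x)_{n,\mu}=\sum_{k=0}^{n}S_{2,\mu}(n,k)(x)_{k}$ for $n\ge0$, with $S_{2,\mu}(n,k)=0$ for $k>n$. A degenerate formal power series is an expression $f_{\lambda}(t)=\sum_{k=0}^{\infty}a_{k}(t)_{k,\lambda}$ with coefficients $a_0,a_1,a_2,\dots$; for a number $w$, $f_\lambda(w)$ denotes the formal sum $\sum_{m=0}^{\infty}a_m (w)_{m,\lambda}$. Each side of an identity is regarded as a formal linear combination $\sum_{m\ge0}a_m c_m$ with $c_m\in\mathbb{C}$, and finite sums are carried out coefficientwise in the $a_m$. *)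

theory Defs
  imports "HOL-Computational_Algebra.Computational_Algebra"
begin

text \<open>
  The \<open>\<mu>\<close>-falling factorial \<open>(x)\<^sub>n\<^sub>,\<^sub>\<mu>\<close>. The ring is left general so that the same
  definition yields numbers and, at the indeterminate \<open>[:0, 1:]\<close>, polynomials. The ordinary
  falling factorial \<open>(x)\<^sub>n\<close> is the instance \<open>\<mu> = 1\<close>.
\<close>

definition dfall :: "'a::comm_ring_1 \<Rightarrow> 'a \<Rightarrow> nat \<Rightarrow> 'a" where
  "dfall \<mu> x n = (\<Prod>i<n. x - of_nat i * \<mu>)"

lemma dfall_0 [simp]: "dfall \<mu> x 0 = 1"
  by (simp add: dfall_def)

lemma dfall_Suc: "dfall \<mu> x (Suc n) = dfall \<mu> x n * (x - of_nat n * \<mu>)"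
  by (simp add: dfall_def)

text \<open>The defining polynomial identity in \<open>x = [:0, 1:]\<close> of the degenerate Stirling numbers.\<close>

definition is_deg_Stirling2 :: "complex \<Rightarrow> (nat \<Rightarrow> nat \<Rightarrow> complex) \<Rightarrow> bool" where
  "is_deg_Stirling2 \<mu> S \<longleftrightarrow>
     (\<forall>n. dfall [:\<mu>:] [:0, 1:] n = (\<Sum>k=0..n. smult (S n k) (dfall 1 [:0, 1:] k))) \<and>
     (\<forall>n k. k > n \<longrightarrow> S n k = 0)"

definition deg_Stirling2 :: "complex \<Rightarrow> nat \<Rightarrow> nat \<Rightarrow> complex" where
  "deg_Stirling2 \<mu> = (THE S. is_deg_Stirling2 \<mu> S)"

text \<open>The numbers exist and are unique, so the definite description is meaningful.\<close>

fun deg_Stirling2_rec :: "complex \<Rightarrow> nat \<Rightarrow> nat \<Rightarrow> complex" where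
  "deg_Stirling2_rec \<mu> 0 k = (if k = 0 then 1 else 0)"
| "deg_Stirling2_rec \<mu> (Suc n) k =
     (if k = 0 then 0 else deg_Stirling2_rec \<mu> n (k - 1)) +
     (of_nat k - of_nat n * \<mu>) * deg_Stirling2_rec \<mu> n k"

lemma deg_Stirling2_rec_eq_0: "k > n \<Longrightarrow> deg_Stirling2_rec \<mu> n k = 0"
  by (induction n arbitrary: k) auto

lemma is_deg_Stirling2_rec: "is_deg_Stirling2 \<mu> (deg_Stirling2_rec \<mu>)"
proof -
  let ?S = "deg_Stirling2_rec \<mu>"
  let ?X = "[:0, 1:] :: complex poly"
  let ?F = "dfall 1 ?X"
  have "dfall [:\<mu>:] ?X n = (\<Sum>k=0..n. smult (?S n k) (?F k))" for n
  proof (induction n)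
    case 0
    show ?case by simp
  next
    case (Suc n)
    have step: "smult c (?F k) * (?X - of_nat n * [:\<mu>:]) =
        smult c (?F (Suc k)) + smult ((of_nat k - of_nat n * \<mu>) * c) (?F k)" for c k
    proof -
      have "?X - of_nat n * [:\<mu>:] = (?X - of_nat k * 1) + [:of_nat k - of_nat n * \<mu>:]"
        by (simp add: of_nat_poly)
      then show ?thesis
        by (simp only: dfall_Suc distrib_left) (simp add: algebra_simps)
    qed
    have "dfall [:\<mu>:] ?X (Suc n) =
        (\<Sum>k=0..n. smult (?S n k) (?F k) * (?X - of_nat n * [:\<mu>:]))"
      by (simp only: dfall_Suc Suc sum_distrib_right)
    also have "\<dots> = (\<Sum>k=0..n. smult (?S n k) (?F (Suc k))) +
        (\<Sum>k=0..n. smult ((of_nat k - of_nat n * \<mu>) * ?S n k) (?F k))"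
      by (simp only: step sum.distrib)
    also have "(\<Sum>k=0..n. smult (?S n k) (?F (Suc k))) =
        (\<Sum>k=0..Suc n. smult (if k = 0 then 0 else ?S n (k - 1)) (?F k))"
      by (subst sum.atLeast0_atMost_Suc_shift) (simp del: sum.cl_ivl_Suc)
    also have "(\<Sum>k=0..n. smult ((of_nat k - of_nat n * \<mu>) * ?S n k) (?F k)) =
        (\<Sum>k=0..Suc n. smult ((of_nat k - of_nat n * \<mu>) * ?S n k) (?F k))"
      by (simp add: deg_Stirling2_rec_eq_0)
    finally show ?case
      by (simp only: sum.distrib [symmetric] smult_add_left [symmetric] deg_Stirling2_rec.simps)
  qed
  then show ?thesis
    unfolding is_deg_Stirling2_def by (simp add: deg_Stirling2_rec_eq_0)
qed

lemma poly_dfall_1: "poly (dfall 1 [:0, 1:] k) (of_nat j :: complex) = (\<Prod>i<k. of_nat j - of_nat i)"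
  by (simp add: dfall_def poly_prod of_nat_poly)

lemma dfall_1_independent:
  fixes c :: "nat \<Rightarrow> complex"
  assumes "(\<Sum>k=0..n. smult (c k) (dfall 1 [:0, 1:] k)) = 0" and "j \<le> n"
  shows "c j = 0"
  using assms(2)
proof (induction j rule: less_induct)
  case (less j)
  let ?g = "\<lambda>k. c k * (\<Prod>i<k. of_nat j - of_nat i)"
  have "0 = poly (\<Sum>k=0..n. smult (c k) (dfall 1 [:0, 1:] k)) (of_nat j)"
    using assms(1) by simp
  also have "\<dots> = (\<Sum>k=0..n. ?g k)"
    by (simp add: poly_sum poly_dfall_1)
  also have "\<dots> = (\<Sum>k\<in>{j}. ?g k)"
  proof (rule sum.mono_neutral_right)
    show "\<forall>k\<in>{0..n} - {j}. ?g k = 0"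
    proof
      fix k assume k: "k \<in> {0..n} - {j}"
      show "?g k = 0"
      proof (cases "k < j")
        case True
        then show ?thesis using less k by simp
      next
        case False
        then have "j < k" using k by simp
        then show ?thesis by (auto intro!: bexI [of _ j])
      qed
    qed
  qed (use less in auto)
  finally have "c j * (\<Prod>i<j. of_nat j - of_nat i) = 0" by simp
  moreover have "(\<Prod>i<j. of_nat j - of_nat i :: complex) \<noteq> 0" by auto
  ultimately show ?case by simp
qed

lemma is_deg_Stirling2_unique:
  assumes "is_deg_Stirling2 \<mu> S" and "is_deg_Stirling2 \<mu> T"
  shows "S = T"
proof (intro ext)
  fix n k
  show "S n k = T n k"
  proof (cases "k \<le> n")
    case True
    have "(\<Sum>k=0..n. smult (S n k - T n k) (dfall 1 [:0, 1:] k)) = 0"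
      using assms by (simp add: is_deg_Stirling2_def smult_diff_left sum_subtractf)
    from dfall_1_independent [OF this True] show ?thesis by simp
  next
    case False
    then show ?thesis using assms by (simp add: is_deg_Stirling2_def)
  qed
qed

lemma is_deg_Stirling2_deg_Stirling2: "is_deg_Stirling2 \<mu> (deg_Stirling2 \<mu>)"
  unfolding deg_Stirling2_def
  by (rule theI [of _ "deg_Stirling2_rec \<mu>"])
    (auto intro: is_deg_Stirling2_rec is_deg_Stirling2_unique)

text \<open>
  A formal linear combination \<open>\<Sum>m. a\<^sub>m c\<^sub>m\<close> of the symbols \<open>a\<^sub>0, a\<^sub>1, \<dots>\<close> is represented by
  the sequence of its coefficients \<open>c\<^sub>m\<close>, stored as a formal power series: the basis monomial
  \<open>X\<^sup>m\<close> plays the role of \<open>a\<^sub>m\<close>. Only equality, addition and multiplication by constants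
  \<open>fps_const c\<close> are used, all of which are coefficientwise; the product of power series has no
  meaning here.
\<close>

definition formal_comb :: "(nat \<Rightarrow> complex) \<Rightarrow> complex fps" where
  "formal_comb c = Abs_fps c"

text \<open>
  The value \<open>f\<^sub>\<lambda>(w) = \<Sum>m. a\<^sub>m (w)\<^sub>m\<^sub>,\<^sub>\<lambda>\<close> of a degenerate formal power series. As the \<open>a\<^sub>m\<close> are
  symbols, they do not occur as an argument.
\<close>

definition deg_fps_at :: "real \<Rightarrow> complex \<Rightarrow> complex fps" where
  "deg_fps_at lam w = formal_comb (\<lambda>m. dfall (complex_of_real lam) w m)"

end

theory Submission
  imports Defs
begin

text \<open>
  The operator \<open>D g = \<Sum>k\<le>n. (n choose k) (-1)\<^sup>k g(k)\<close> is, up to the sign \<open>(-1)\<^sup>n\<close>, the \<open>n\<close>-th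
  forward difference at \<open>0\<close>. It therefore picks out the \<open>n\<close>-th coefficient of an expansion in
  ordinary falling factorials: \<open>(k)\<^sub>j = j! (k choose j)\<close>, and the binomial coefficients
  \<open>k choose j\<close> are the dual basis to the differences (\<open>sum_alternating_choose_choose\<close>). Since the
  degenerate Stirling numbers are by definition such coefficients, applying \<open>D\<close> to
  \<open>(k)\<^sub>p\<^sub>,\<^sub>\<mu>\<close> gives \<open>(-1)\<^sup>n n! S(p, n)\<close> (\<open>sum_alternating_dfall_of_nat\<close>).

  Two properties of degenerate falling factorials reduce both identities to this case. By
  homogeneity, \<open>(z k)\<^sub>p\<^sub>,\<^sub>\<lambda> = z\<^sup>p (k)\<^sub>p\<^sub>,\<^sub>\<mu>\<close> with \<open>\<mu> = \<lambda> / z\<close> (\<open>dfall_mult\<close>), which is where the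
  parameter \<open>\<lambda> / z\<close> comes from. By the Vandermonde identity (\<open>dfall_add\<close>), \<open>(y + z k)\<^sub>m\<^sub>,\<^sub>\<lambda>\<close> is
  a binomial convolution of \<open>(z k)\<^sub>p\<^sub>,\<^sub>\<lambda>\<close> with \<open>(y)\<^sub>m\<^sub>-\<^sub>p\<^sub>,\<^sub>\<lambda>\<close>, and the second factor does not
  depend on \<open>k\<close>.
\<close>

lemma dfall_mult: "dfall (z * \<mu>) (z * x) p = z ^ p * dfall \<mu> x p"
proof -
  have "dfall (z * \<mu>) (z * x) p = (\<Prod>i<p. z * (x - of_nat i * \<mu>))"
    by (simp add: dfall_def algebra_simps)
  then show ?thesis
    by (simp add: dfall_def prod.distrib)
qed

text \<open>
  The falling factorials are of binomial type because the step from \<open>m\<close> to \<open>m + 1\<close> multiplies by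
  \<open>x + y - m\<mu> = (x - p\<mu>) + (y - (m - p)\<mu>)\<close>: each summand raises either the first or the second
  index, and Pascal's rule collects the two contributions.
\<close>

lemma dfall_add:
  "dfall \<mu> (x + y) m = (\<Sum>p\<le>m. of_nat (m choose p) * dfall \<mu> x p * dfall \<mu> y (m - p))"
proof (induction m)
  case 0
  show ?case by simp
next
  case (Suc m)
  let ?t = "\<lambda>c p q. of_nat c * dfall \<mu> x p * dfall \<mu> y q"
  have step: "?t (m choose p) p (m - p) * (x + y - of_nat m * \<mu>) =
      ?t (m choose p) (Suc p) (m - p) + ?t (m choose p) p (Suc m - p)" if p_le: "p \<le> m" for p
  proof -
    obtain q where m: "m = p + q"
      using p_le le_Suc_ex by blast
    have "Suc m - p = Suc q" and "m - p = q"
      using m by auto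
    then show ?thesis
      by (simp only: dfall_Suc) (simp add: m algebra_simps)
  qed
  have "dfall \<mu> (x + y) (Suc m) =
      (\<Sum>p\<le>m. ?t (m choose p) p (m - p) * (x + y - of_nat m * \<mu>))"
    by (simp only: dfall_Suc Suc sum_distrib_right)
  also have "\<dots> = (\<Sum>p\<le>m. ?t (m choose p) (Suc p) (m - p)) +
      (\<Sum>p\<le>m. ?t (m choose p) p (Suc m - p))"
    by (simp add: step sum.distrib)
  also have "(\<Sum>p\<le>m. ?t (m choose p) p (Suc m - p)) =
      (\<Sum>p\<le>Suc m. ?t (m choose p) p (Suc m - p))"
    by (simp add: binomial_eq_0)
  also have "\<dots> = ?t 1 0 (Suc m) + (\<Sum>p\<le>m. ?t (m choose Suc p) (Suc p) (m - p))"
    by (simp only: sum.atMost_Suc_shift) simp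
  finally have "dfall \<mu> (x + y) (Suc m) =
      ?t 1 0 (Suc m) + (\<Sum>p\<le>m. ?t (Suc m choose Suc p) (Suc p) (m - p))"
    by (simp add: sum.distrib [symmetric] algebra_simps)
  also have "\<dots> = (\<Sum>p\<le>Suc m. ?t (Suc m choose p) p (Suc m - p))"
    by (simp only: sum.atMost_Suc_shift) simp
  finally show ?case .
qed

lemma dfall_1_of_nat:
  "dfall 1 (of_nat k :: 'a::field_char_0) j = fact j * of_nat (k choose j)"
  by (simp add: dfall_def binomial_gbinomial gbinomial_prod_rev atLeast0LessThan)

text \<open>
  For \<open>j \<le> n\<close>, choosing \<open>k\<close> out of \<open>n\<close> and then \<open>j\<close> out of these \<open>k\<close> is choosing \<open>j\<close> out of
  \<open>n\<close> and then \<open>k - j\<close> of the others. What remains is the alternating sum of a row of Pascal's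
  triangle, which vanishes unless the row is that of \<open>n - j = 0\<close>.
\<close>

lemma sum_alternating_choose_choose:
  "(\<Sum>k\<le>n. of_nat (n choose k) * (-1) ^ k * of_nat (k choose j)) =
     (if j = n then (-1) ^ n else 0 :: 'a::comm_ring_1)"
proof (cases "j \<le> n")
  case False
  then show ?thesis by (auto simp: binomial_eq_0 intro!: sum.neutral)
next
  case True
  then obtain d where n: "n = j + d"
    using le_Suc_ex by blast
  have "(\<Sum>k\<le>n. of_nat (n choose k) * (-1) ^ k * of_nat (k choose j) :: 'a) =
      (\<Sum>k\<in>{j..n}. of_nat (n choose k) * (-1) ^ k * of_nat (k choose j))"
    by (rule sum.mono_neutral_right) (auto simp: binomial_eq_0)
  also have "\<dots> = (\<Sum>i\<le>d. of_nat (n choose (i + j)) * (-1) ^ (i + j) * of_nat ((i + j) choose j))"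
    using sum.shift_bounds_cl_nat_ivl [of _ 0 j d] by (simp add: n add.commute atMost_atLeast0)
  also have "\<dots> = (\<Sum>i\<le>d. of_nat (n choose j) * (-1) ^ j * ((-1) ^ i * of_nat (d choose i)))"
  proof (rule sum.cong)
    fix i assume "i \<in> {..d}"
    then have "(n choose (i + j)) * ((i + j) choose j) = (n choose j) * (d choose i)"
      using choose_mult [of j "i + j" n] by (simp add: n)
    then have "of_nat (n choose (i + j)) * of_nat ((i + j) choose j) =
        (of_nat (n choose j) * of_nat (d choose i) :: 'a)"
      by (metis of_nat_mult)
    then show "of_nat (n choose (i + j)) * (-1) ^ (i + j) * of_nat ((i + j) choose j) =
        (of_nat (n choose j) * (-1) ^ j * ((-1) ^ i * of_nat (d choose i)) :: 'a)"
      by (simp add: power_add mult_ac)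
  qed simp
  also have "\<dots> = of_nat (n choose j) * (-1) ^ j * (\<Sum>i\<le>d. (-1) ^ i * of_nat (d choose i))"
    by (rule sum_distrib_left [symmetric])
  also have "\<dots> = (if j = n then (-1) ^ n else 0)"
    using choose_alternating_sum [of d, where 'a = 'a] by (cases "d = 0") (auto simp: n)
  finally show ?thesis .
qed

lemma dfall_eq_sum_deg_Stirling2:
  "dfall \<mu> x p = (\<Sum>j\<le>p. deg_Stirling2 \<mu> p j * dfall 1 x j)"
proof -
  have eval: "poly (dfall [:c:] [:0, 1:] j) x = dfall c x j" for c :: complex and j
    by (simp add: dfall_def poly_prod of_nat_poly mult.commute)
  have "dfall [:\<mu>:] [:0, 1:] p = (\<Sum>j=0..p. smult (deg_Stirling2 \<mu> p j) (dfall 1 [:0, 1:] j))"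
    using is_deg_Stirling2_deg_Stirling2 unfolding is_deg_Stirling2_def by blast
  from arg_cong [OF this, of "\<lambda>q. poly q x"] show ?thesis
    using eval [of 1] by (simp add: eval poly_sum one_pCons atMost_atLeast0)
qed

text \<open>The degenerate form of \<open>n! S(p, n) = \<Sum>k\<le>n. (-1)\<^sup>n\<^sup>-\<^sup>k (n choose k) k\<^sup>p\<close>.\<close>

lemma sum_alternating_dfall_of_nat:
  "(\<Sum>k\<le>n. of_nat (n choose k) * (-1) ^ k * dfall \<mu> (of_nat k) p) =
     (-1) ^ n * fact n * deg_Stirling2 \<mu> p n"
proof -
  let ?S = "deg_Stirling2 \<mu> p"
  have "(\<Sum>k\<le>n. of_nat (n choose k) * (-1) ^ k * dfall \<mu> (of_nat k) p) =
      (\<Sum>k\<le>n. \<Sum>j\<le>p. ?S j * fact j * (of_nat (n choose k) * (-1) ^ k * of_nat (k choose j)))"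
    by (simp add: dfall_eq_sum_deg_Stirling2 [of \<mu>] dfall_1_of_nat sum_distrib_left mult_ac)
  also have "\<dots> = (\<Sum>j\<le>p. ?S j * fact j *
      (\<Sum>k\<le>n. of_nat (n choose k) * (-1) ^ k * of_nat (k choose j)))"
    by (subst sum.swap) (simp only: sum_distrib_left)
  also have "\<dots> = (\<Sum>j\<le>p. if j = n then ?S n * fact n * (-1) ^ n else 0)"
    by (intro sum.cong) (auto simp: sum_alternating_choose_choose)
  also have "\<dots> = (-1) ^ n * fact n * ?S n"
    \<comment> \<open>If \<open>n\<close> lies outside the range of \<open>j\<close>, both sides vanish.\<close>
    using is_deg_Stirling2_deg_Stirling2 [of \<mu>] by (auto simp: is_deg_Stirling2_def)
  finally show ?thesis .
qed

lemma sum_alternating_dfall_mult_of_nat: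
  assumes "z \<noteq> 0"
  shows "(\<Sum>k\<le>n. of_nat (n choose k) * (-1) ^ k * dfall lam (z * of_nat k) p) =
     (-1) ^ n * fact n * (deg_Stirling2 (lam / z) p n * z ^ p)"
proof -
  have "dfall lam (z * of_nat k) p = z ^ p * dfall (lam / z) (of_nat k) p" for k
    using dfall_mult [of z "lam / z"] assms by simp
  then have "(\<Sum>k\<le>n. of_nat (n choose k) * (-1) ^ k * dfall lam (z * of_nat k) p) =
      z ^ p * (\<Sum>k\<le>n. of_nat (n choose k) * (-1) ^ k * dfall (lam / z) (of_nat k) p)"
    by (simp add: sum_distrib_left mult_ac)
  then show ?thesis
    by (simp add: sum_alternating_dfall_of_nat)
qed

lemma sum_alternating_dfall_add_mult_of_nat:
  assumes "z \<noteq> 0"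
  shows "(\<Sum>k\<le>n. of_nat (n choose k) * (-1) ^ k * dfall lam (y + z * of_nat k) m) =
     (-1) ^ n * fact n *
       (\<Sum>p\<le>m. of_nat (m choose p) * deg_Stirling2 (lam / z) p n * z ^ p * dfall lam y (m - p))"
proof -
  have "(\<Sum>k\<le>n. of_nat (n choose k) * (-1) ^ k * dfall lam (y + z * of_nat k) m) =
      (\<Sum>k\<le>n. \<Sum>p\<le>m. of_nat (m choose p) * dfall lam y (m - p) *
        (of_nat (n choose k) * (-1) ^ k * dfall lam (z * of_nat k) p))"
    by (simp add: add.commute [of y] dfall_add sum_distrib_left mult_ac)
  also have "\<dots> = (\<Sum>p\<le>m. of_nat (m choose p) * dfall lam y (m - p) *
      (\<Sum>k\<le>n. of_nat (n choose k) * (-1) ^ k * dfall lam (z * of_nat k) p))"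
    by (subst sum.swap) (simp only: sum_distrib_left)
  finally show ?thesis
    by (simp only: sum_alternating_dfall_mult_of_nat [OF assms])
      (simp add: sum_distrib_left mult_ac)
qed

theorem theorem3:
  fixes lam :: real and y z :: complex and n :: nat
  assumes "z \<noteq> 0"
  shows "((\<Sum>k=0..n. fps_const (of_nat (n choose k) * (-1) ^ k) * deg_fps_at lam (y + z * of_nat k)) =
           fps_const ((-1) ^ n * fact n) *
           formal_comb (\<lambda>m. \<Sum>p=0..m. of_nat (m choose p) * deg_Stirling2 (complex_of_real lam / z) p n
                              * z ^ p * dfall (complex_of_real lam) y (m - p)))
       \<and> ((\<Sum>k=0..n. fps_const (of_nat (n choose k) * (-1) ^ k) * deg_fps_at lam (z * of_nat k)) =
           fps_const ((-1) ^ n * fact n) *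
           formal_comb (\<lambda>m. deg_Stirling2 (complex_of_real lam / z) m n * z ^ m))"
proof -
  have coeff: "fps_nth (\<Sum>k=0..n. fps_const (of_nat (n choose k) * (-1) ^ k) * deg_fps_at lam (w k)) m =
      (\<Sum>k\<le>n. of_nat (n choose k) * (-1) ^ k * dfall (complex_of_real lam) (w k) m)" for w m
    by (simp add: fps_sum_nth deg_fps_at_def formal_comb_def atMost_atLeast0)
  show ?thesis
    unfolding fps_eq_iff coeff
    by (simp add: formal_comb_def atMost_atLeast0 [symmetric]
      sum_alternating_dfall_add_mult_of_nat [OF assms] sum_alternating_dfall_mult_of_nat [OF assms])
qed

end
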